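(* Let $d\in\{2,3\}$ and consider the leader–follower nonholonomic multi-agent system, graph, and moving target formation $\bm p^*(t)$ described in the context, with $n_l\ge 2$ leaders moving along $\bm p_i(t)=\bm p_i^*(t)=\bm p_i^*(0)+\bm v_c t$. Suppose that the desired formation $(\bar{\mathcal G},\bm p^* )$ is infinitesimally bearing rigid. Let every follower $i\in\mathcal V_f$ use the displacement-based control law $$u_i=\bm h_i^\top(k_1\bm r_i+\bm\xi_i),\qquad \dot{\bm\xi}_i=\bm h_i\bm h_i^\top\bm r_i-(\bm I_d-\bm h_i\bm h_i^\top)\bm\xi_i,\qquad \bm\omega_i=\bm h_i\times k_2(\bm r_i+\bm\xi_i),$$ with $\bm r_i=-\sum_{j\in\mathcal N_i}\bm P_{\bm g_{ij}^*}(\bm p_i-\bm p_j)$ and constants $k_1,k_2>0$, so that the followers obey the closed-loop equations $$\dot{\bm p}_i=\bm h_i\bm h_i^\top(k_1\bm r_i+\bm\xi_i),\quad \dot{\bm\xi}_i=\bm h_i\bm h_i^\top\bm r_i-(\bm I_d-\bm h_i\bm h_i^\top)\bm\xi_i,\quad \dot{\bm h}_i=k_2(\bm I_d-\bm h_i\bm h_i^\top)(\bm r_i+\bm\xi_i).$$ Then $\bm p(t)\to\bm p^*(t)$ globally and asymptotically, i.e. for all initial follower positions $\bm p_i(0)\in\mathbb R^d$, unit headings $\bm h_i(0)$ and auxiliary vectors $\bm\xi_i(0)\in\mathbb R^d$ ($i\in\mathcal V_f$), one has $\|\bm p(t)-\bm p^*(t)\|\to 0$ as $t\to\infty$.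
   Context: **Agents.** There are $n$ agents in $\mathbb R^d$, $d\in\{2,3\}$, with index set $\mathcal V=\{1,\dots,n\}$. Agent $i$ has position $\bm p_i\in\mathbb R^d$ and unit heading vector $\bm h_i\in\mathbb R^d$, with kinematics $\dot{\bm p}_i=\bm h_i u_i$, $\dot{\bm h}_i=\bm\omega_i\times\bm h_i$, where $u_i\in\mathbb R$ is the forward velocity and $\bm\omega_i$ the angular velocity. (With $\bm\omega_i=\bm h_i\times k_2\bm y$ this gives $\dot{\bm h}_i=k_2(\bm I_d-\bm h_i\bm h_i^\top)\bm y$; for $d=2$ the cross product is understood via embedding in $\mathbb R^3$, and the latter formula is what is meant.) Write $\bm p=(\bm p_1^\top,\dots,\bm p_n^\top)^\top\in\mathbb R^{dn}$. **Leaders and followers.** $\mathcal V_l=\{1,\dots,n_l\}$ is the set of leaders, $n_l\ge2$, and $\mathcal V_f=\mathcal V\setminus\mathcal V_l$ is the set of followers. **Graph.** $\mathcal G=(\mathcal V,\mathcal E)$ is an undirected sensing graph. The augmented graph $\bar{\mathcal G}=(\mathcal V,\bar{\mathcal E})$ is obtained by adding an edge between every two leaders. $\mathcal N_i$ is the set of neighbors of $i$ (for a follower it is the same in $\mathcal G$ and $\bar{\mathcal G}$). **Target formation.** $\bm v_c\in\mathbb R^d$ is a constant vector (the leaders' common velocity, $\bm v_c=u_c\bm h_c$ with $\bm h_c$ the leaders' common constant unit heading and $|u_c|=\|\bm v_c\|$). The moving target formation is $\bm p^*(t)=(\bm p_1^*(t)^\top,\dots,\bm p_n^*(t)^\top)^\top$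 with $\bm p_i^*(t)=\bm p_i^*(0)+\bm v_c t$ for all $i\in\mathcal V$, where $\bm p_i^*\ne\bm p_j^*$ for $(i,j)\in\bar{\mathcal E}$. The constant desired bearings are $\bm g_{ij}^*=(\bm p_j^*-\bm p_i^* )/\|\bm p_j^*-\bm p_i^*\|$, $(i,j)\in\bar{\mathcal E}$, and $\bm P_{\bm g}=\bm I_d-\bm g\bm g^\top$ for a unit vector $\bm g$. Leaders satisfy $\bm p_i(t)=\bm p_i^*(t)$ and $\bm h_i=\bm h_c$ for all $t\ge0$. **Infinitesimal bearing rigidity.** The bearing Laplacian $\bm{\mathcal B}\in\mathbb R^{dn\times dn}$ of $(\bar{\mathcal G},\bm p^* )$ has $d\times d$ blocks $[\bm{\mathcal B}]_{ij}=-\bm P_{\bm g_{ij}^*}$ for $i\ne j$, $(i,j)\in\bar{\mathcal E}$; $[\bm{\mathcal B}]_{ii}=\sum_{k:(i,k)\in\bar{\mathcal E}}\bm P_{\bm g_{ik}^*}$; and zero otherwise. $(\bar{\mathcal G},\bm p^* )$ is infinitesimally bearing rigid iff $\mathrm{null}(\bm{\mathcal B})=\mathrm{span}(\bm 1_n\otimes\bm I_d,\bm p^* )$ (i.e. $\operatorname{rank}\bm{\mathcal B}=dn-d-1$): the only infinitesimal motions preserving the bearings are translations and scaling. *)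

theory Defs
  imports "HOL-Analysis.Analysis"
begin

text \<open>Agents are the elements of a finite type \<^typ>\<open>'v\<close>, so a configuration of all
  agents is a vector of type \<^typ>\<open>real^'d^'v\<close>; its Euclidean norm is the norm of the
  stacked vector in dimension \<open>d n\<close>. A graph is its set of ordered edges.\<close>

definition outer :: "real^'d \<Rightarrow> real^'d \<Rightarrow> real^'d^'d" where
  "outer x y = (\<chi> a b. x $ a * y $ b)"

definition orth_proj :: "real^'d \<Rightarrow> real^'d^'d" where
  "orth_proj g = mat 1 - outer g g"

definition bearing :: "real^'d^'v \<Rightarrow> 'v \<Rightarrow> 'v \<Rightarrow> real^'d" where
  "bearing q i j = (q $ j - q $ i) /\<^sub>R norm (q $ j - q $ i)"

definition augmented_edges :: "('v \<times> 'v) set \<Rightarrow> 'v set \<Rightarrow> ('v \<times> 'v) set" where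
  "augmented_edges E L = E \<union> {(i, j). i \<in> L \<and> j \<in> L \<and> i \<noteq> j}"

definition target :: "real^'d^'v \<Rightarrow> real^'d \<Rightarrow> real \<Rightarrow> real^'d^'v" where
  "target q v t = (\<chi> i. q $ i + t *\<^sub>R v)"

text \<open>The desired bearings are constant along the moving target formation.\<close>

lemma bearing_target: "bearing (target q v t) i j = bearing q i j"
  by (simp add: bearing_def target_def)

definition stack :: "real^'d^'v \<Rightarrow> real^('v \<times> 'd)" where
  "stack x = (\<chi> k. x $ fst k $ snd k)"

definition laplacian_block :: "('v::finite \<times> 'v) set \<Rightarrow> real^'d^'v \<Rightarrow> 'v \<Rightarrow> 'v \<Rightarrow> real^'d^'d" where
  "laplacian_block E q i j =
     (if i = j then \<Sum>k | (i, k) \<in> E. orth_proj (bearing q i k)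
      else if (i, j) \<in> E then - orth_proj (bearing q i j)
      else 0)"

definition bearing_laplacian ::
    "('v::finite \<times> 'v) set \<Rightarrow> real^'d^'v \<Rightarrow> real^('v \<times> 'd)^('v \<times> 'd)" where
  "bearing_laplacian E q = (\<chi> k l. laplacian_block E q (fst k) (fst l) $ snd k $ snd l)"

text \<open>The vectors \<open>stack (\<chi> i. axis a 1)\<close> are the columns of \<open>1\<^sub>n \<otimes> I\<^sub>d\<close>.\<close>

definition inf_bearing_rigid :: "('v::finite \<times> 'v) set \<Rightarrow> real^'d^'v \<Rightarrow> bool" where
  "inf_bearing_rigid E q \<longleftrightarrow>
     {x. bearing_laplacian E q *v x = 0} =
     span (insert (stack q) (range (\<lambda>a. stack (\<chi> i. axis a 1))))"

definition displacement_input ::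
    "('v::finite \<times> 'v) set \<Rightarrow> real^'d^'v \<Rightarrow> real^'d^'v \<Rightarrow> 'v \<Rightarrow> real^'d" where
  "displacement_input E q p i =
     - (\<Sum>j | (i, j) \<in> E. orth_proj (bearing q i j) *v (p $ i - p $ j))"

end

theory Submission
  imports Defs
begin

text \<open>Let \<open>e = p - p\<^sup>*\<close> and let \<open>P\<^sub>h\<close> be the projection orthogonal to \<open>h\<close>. The function
  \<open>\<onehalf> e\<^sup>T B e + \<Sum>\<^sub>i (\<onehalf> \<bar>\<xi>\<^sub>i - v\<^sub>c\<bar>\<^sup>2 + (\<bar>v\<^sub>c\<bar> - v\<^sub>c \<bullet> h\<^sub>i) / k\<^sub>2)\<close>, summed over the followers, has derivative
  \<open>- \<Sum>\<^sub>i (k\<^sub>1 (h\<^sub>i \<bullet> r\<^sub>i)\<^sup>2 + \<bar>P\<^bsub>h\<^sub>i\<^esub> \<xi>\<^sub>i\<bar>\<^sup>2)\<close>. Rigidity makes the first term coercive in \<open>e\<close>, so all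
  signals are bounded and Barbalat's lemma gives \<open>h\<^sub>i \<bullet> r\<^sub>i \<rightarrow> 0\<close> and \<open>P\<^bsub>h\<^sub>i\<^esub> \<xi>\<^sub>i \<rightarrow> 0\<close>. Up to
  vanishing terms the bounded \<open>e\<^sub>i\<close> then has the slowly varying velocity \<open>\<xi>\<^sub>i - v\<^sub>c\<close>, which must
  therefore vanish in the limit. Hence \<open>r\<^sub>i\<close> varies slowly too, and since the bounded \<open>h\<^sub>i\<close> has velocity
  \<open>k\<^sub>2 r\<^sub>i\<close> up to vanishing terms, also \<open>r\<^sub>i \<rightarrow> 0\<close>; coercivity gives \<open>e \<rightarrow> 0\<close>.\<close>

section \<open>Asymptotics of differentiable curves\<close>

lemma vector_derivative_bound_Icc:
  fixes f :: "real \<Rightarrow> 'a::real_normed_vector"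
  assumes "a \<le> b"
    and "\<And>t. t \<in> {a..b} \<Longrightarrow> (f has_vector_derivative f' t) (at t within {a..b})"
    and "\<And>t. t \<in> {a..b} \<Longrightarrow> norm (f' t) \<le> B"
  shows "norm (f b - f a) \<le> B * (b - a)"
proof -
  have "onorm (\<lambda>x. x *\<^sub>R f' t) \<le> B" if "t \<in> {a..b}" for t
    using assms(3)[OF that] by (intro onorm_le) (simp add: mult.commute[of B] mult_left_mono)
  then have "norm (f b - f a) \<le> B * norm (b - a)"
    using assms by (intro differentiable_bound[of "{a..b}" f "\<lambda>t x. x *\<^sub>R f' t"])
      (auto simp: has_vector_derivative_def)
  then show ?thesis using \<open>a \<le> b\<close> by simp
qed

lemma uniformly_continuous_on_bounded_vector_derivative:
  fixes f :: "real \<Rightarrow> 'a::real_normed_vector"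
  assumes "\<And>t. t \<ge> 0 \<Longrightarrow> (f has_vector_derivative f' t) (at t within {0..})"
    and "bounded (f' ` {0..})"
  shows "uniformly_continuous_on {0..} f"
proof -
  obtain B where "B > 0" and B: "\<And>t. t \<ge> 0 \<Longrightarrow> norm (f' t) \<le> B"
    using assms(2) by (auto simp: bounded_pos)
  have "B-lipschitz_on {0..} f"
  proof (rule bounded_derivative_imp_lipschitz[where f' = "\<lambda>t x. x *\<^sub>R f' t"])
    show "onorm (\<lambda>x. x *\<^sub>R f' t) \<le> B" if "t \<in> {0..}" for t
      using B that by (intro onorm_le) (simp add: mult.commute[of B] mult_left_mono)
  qed (use assms(1) \<open>B > 0\<close> in \<open>auto simp: has_vector_derivative_def\<close>)
  then show ?thesis by (rule lipschitz_on_uniformly_continuous)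
qed

text \<open>Every basis vector of the product space is supported on a single component. This allows
  derivatives to be assembled agent by agent, with leaders and followers treated separately.\<close>

lemma has_vector_derivative_vecI:
  fixes f :: "real \<Rightarrow> 'a::euclidean_space^'n"
  assumes "\<And>i. ((\<lambda>t. f t $ i) has_vector_derivative f' $ i) (at t within S)"
  shows "(f has_vector_derivative f') (at t within S)"
  unfolding has_vector_derivative_def
proof (subst has_derivative_componentwise_within, safe)
  fix b :: "'a^'n" assume "b \<in> Basis"
  then obtain i u where b: "b = axis i u" by (auto simp: Basis_vec_def)
  show "((\<lambda>x. f x \<bullet> b) has_derivative (\<lambda>x. x *\<^sub>R f' \<bullet> b)) (at t within S)"
    using has_derivative_inner_left[OF assms[unfolded has_vector_derivative_def], of i u]
    by (simp add: b inner_axis)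
qed

lemma bounded_continuous_image:
  fixes f :: "'a::heine_borel \<Rightarrow> 'b::metric_space"
  assumes "bounded S" "continuous_on UNIV f"
  shows "bounded (f ` S)"
proof (rule bounded_subset)
  show "bounded (f ` closure S)"
    using assms
    by (intro compact_imp_bounded compact_continuous_image continuous_on_subset[OF assms(2)])
      (auto simp: compact_closure)
  show "f ` S \<subseteq> f ` closure S" using closure_subset by (rule image_mono)
qed

lemma bounded_vecI:
  fixes f :: "'b \<Rightarrow> 'a::real_normed_vector^'n"
  assumes "\<And>i. bounded ((\<lambda>t. f t $ i) ` S)"
  shows "bounded (f ` S)"
proof -
  have "\<exists>B. \<forall>t\<in>S. norm (f t $ i) \<le> B" for i
    using assms[of i] by (auto simp: bounded_iff)
  then obtain B where B: "\<And>i t. t \<in> S \<Longrightarrow> norm (f t $ i) \<le> B i" by metis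
  have "norm (f t) \<le> (\<Sum>i\<in>UNIV. B i)" if "t \<in> S" for t
    unfolding norm_vec_def using B[OF that]
    by (intro order_trans[OF L2_set_le_sum] sum_mono) auto
  then show ?thesis by (auto simp: bounded_iff)
qed

lemma real_derivative_bound_Icc:
  fixes f :: "real \<Rightarrow> real"
  assumes "a \<le> b"
    and "\<And>t. t \<in> {a..b} \<Longrightarrow> (f has_real_derivative f' t) (at t within {a..b})"
    and "\<And>t. t \<in> {a..b} \<Longrightarrow> f' t \<le> B"
  shows "f b - f a \<le> B * (b - a)"
proof -
  obtain t where "t \<in> {a..b}" "f b - f a = f' t * (b - a)"
    using mvt_very_simple[OF \<open>a \<le> b\<close>, of f "\<lambda>t. (*) (f' t)"] assms(2)
    by (auto simp: has_field_derivative_def)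
  then show ?thesis using assms(1,3) by (auto intro: mult_right_mono)
qed

text \<open>Suppose \<open>w t\<close> reaches \<open>e\<close>. By uniform continuity
  \<open>w\<close> stays above \<open>e / 2\<close> on a window of length \<open>d / 2\<close>, so
  \<open>V\<close> loses at least \<open>e * d / 4\<close> there. This is impossible once
  \<open>V\<close> is within \<open>e * d / 4\<close> of its infimum, so no integral of
  \<open>w\<close> has to be formed.\<close>

lemma barbalat_lyapunov:
  fixes V w :: "real \<Rightarrow> real"
  assumes V: "\<And>t. t \<ge> 0 \<Longrightarrow> (V has_real_derivative V' t) (at t within {0..})"
    and V': "\<And>t. t \<ge> 0 \<Longrightarrow> V' t \<le> - w t"
    and w: "\<And>t. t \<ge> 0 \<Longrightarrow> 0 \<le> w t" "uniformly_continuous_on {0..} w"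
    and lower: "\<And>t. t \<ge> 0 \<Longrightarrow> c \<le> V t"
  shows "(w \<longlongrightarrow> 0) at_top"
proof (rule tendstoI)
  fix e :: real assume "e > 0"
  have decr: "V t - V s \<le> - a * (t - s)"
    if "0 \<le> s" "s \<le> t" "\<And>u. u \<in> {s..t} \<Longrightarrow> a \<le> w u" for s t a
  proof (rule real_derivative_bound_Icc[OF \<open>s \<le> t\<close>])
    fix u assume u: "u \<in> {s..t}"
    show "(V has_real_derivative V' u) (at u within {s..t})"
      using u that by (intro DERIV_subset[OF V]) auto
    show "V' u \<le> - a" using V'[of u] that(3)[OF u] u that(1) by auto
  qed
  obtain d where "d > 0"
    and d: "\<And>s t. s \<ge> 0 \<Longrightarrow> t \<ge> 0 \<Longrightarrow> dist s t < d \<Longrightarrow> dist (w s) (w t) < e / 2"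
    using w(2) \<open>e > 0\<close> unfolding uniformly_continuous_on_def
    by (metis atLeast_iff half_gt_zero)
  have bdd: "bdd_below (V ` {0..})" using lower by (auto intro!: bdd_belowI2)
  define l where "l = Inf (V ` {0..})"
  have l: "l \<le> V t" if "t \<ge> 0" for t
    unfolding l_def using that bdd by (auto intro: cInf_lower)
  have "Inf (V ` {0..}) < l + e * d / 4"
    unfolding l_def[symmetric] using \<open>e > 0\<close> \<open>d > 0\<close> by simp
  then obtain T where "T \<ge> 0" and T: "V T < l + e * d / 4"
    using bdd by (subst (asm) cInf_less_iff) auto
  have "w t < e" if "t \<ge> T" for t
  proof (rule ccontr)
    assume "\<not> w t < e"
    \<comment> \<open>The decay rate 0 expresses that \<open>V\<close> never rises again after
      \<open>T\<close>, so it is still within \<open>e * d / 4\<close> of \<open>l\<close> at time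
      \<open>t\<close>.\<close>
    have "V t - V T \<le> - 0 * (t - T)"
      using \<open>T \<ge> 0\<close> that w(1) by (intro decr) auto
    moreover have "V (t + d / 2) - V t \<le> - (e / 2) * (t + d / 2 - t)"
    proof (rule decr)
      fix u assume "u \<in> {t..t + d / 2}"
      then have "dist (w u) (w t) < e / 2"
        using \<open>T \<ge> 0\<close> \<open>d > 0\<close> that by (intro d) (auto simp: dist_real_def)
      then show "e / 2 \<le> w u"
        using \<open>\<not> w t < e\<close> unfolding dist_real_def by linarith
    qed (use \<open>T \<ge> 0\<close> \<open>d > 0\<close> that in auto)
    moreover have "l \<le> V (t + d / 2)" using \<open>T \<ge> 0\<close> \<open>d > 0\<close> that by (intro l) auto
    ultimately show False using T by (simp add: algebra_simps)
  qed
  then show "\<forall>\<^sub>F t in at_top. dist (w t) 0 < e"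
    using w(1) \<open>T \<ge> 0\<close> by (intro eventually_at_top_linorderI[of T]) auto
qed

text \<open>On a window of fixed length \<open>T\<close> the slowly varying \<open>y\<close> is nearly constant, so
  \<open>x\<close> travels about \<open>T * norm (y t)\<close>; boundedness of \<open>x\<close> forces \<open>y\<close> to be small.\<close>

lemma bounded_slow_drift_tendsto_0:
  fixes x y z :: "real \<Rightarrow> 'a::real_normed_vector"
  assumes x: "\<And>t. t \<ge> 0 \<Longrightarrow> (x has_vector_derivative y t + z t) (at t within {0..})"
    and "bounded (x ` {0..})"
    and y: "\<And>t. t \<ge> 0 \<Longrightarrow> (y has_vector_derivative y' t) (at t within {0..})"
    and y': "(y' \<longlongrightarrow> 0) at_top" and z: "(z \<longlongrightarrow> 0) at_top"
  shows "(y \<longlongrightarrow> 0) at_top"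
proof (rule tendstoI)
  fix e :: real assume "e > 0"
  obtain M where "M > 0" and M: "\<And>t. t \<ge> 0 \<Longrightarrow> norm (x t) \<le> M"
    using assms(2) by (auto simp: bounded_pos)
  \<comment> \<open>With this length the bound \<open>2 * M\<close> on the displacement of
    \<open>x\<close> equals \<open>e / 4 * T\<close>. The deviations \<open>y s - y t\<close> and
    \<open>z s\<close> add at most \<open>e / 4\<close> each to the velocity, which leaves
    \<open>norm (y t) <= 3 / 4 * e\<close>.\<close>
  define T where "T = 8 * M / e"
  have "T > 0" using \<open>M > 0\<close> \<open>e > 0\<close> by (simp add: T_def)
  \<comment> \<open>The factor \<open>1 / T\<close> limits the change of \<open>y\<close> over a
    whole window of length \<open>T\<close> to \<open>e / 4\<close>.\<close>
  have "\<forall>\<^sub>F t in at_top. dist (y' t) 0 < e / (4 * T) \<and> dist (z t) 0 < e / 4"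
    using tendstoD[OF y', of "e / (4 * T)"] tendstoD[OF z, of "e / 4"] \<open>e > 0\<close> \<open>T > 0\<close>
    by (intro eventually_conj) auto
  then obtain N0 where N0: "\<And>t. t \<ge> N0 \<Longrightarrow> norm (y' t) < e / (4 * T) \<and> norm (z t) < e / 4"
    by (auto simp: eventually_at_top_linorder)
  define N where "N = max N0 0"
  have N: "norm (y' t) \<le> e / (4 * T)" "norm (z t) \<le> e / 4" "t \<ge> 0" if "t \<ge> N" for t
    using N0[of t] that by (auto simp: N_def)
  have "norm (y t) < e" if "t \<ge> N" for t
  proof -
    have y_near: "norm (y s - y t) \<le> e / 4" if s: "s \<in> {t..t + T}" for s
    proof -
      have "norm (y s - y t) \<le> e / (4 * T) * (s - t)"
      proof (rule vector_derivative_bound_Icc)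
        fix u assume u: "u \<in> {t..s}"
        then show "(y has_vector_derivative y' u) (at u within {t..s})"
          using N(3) \<open>t \<ge> N\<close>
          by (intro has_vector_derivative_within_subset[OF y]) (auto intro: order_trans)
        show "norm (y' u) \<le> e / (4 * T)" using u \<open>t \<ge> N\<close> by (intro N) auto
      qed (use s in auto)
      also have "\<dots> \<le> e / (4 * T) * T"
        using s \<open>e > 0\<close> \<open>T > 0\<close> by (intro mult_left_mono) auto
      finally show ?thesis using \<open>T > 0\<close> by simp
    qed
    \<comment> \<open>Subtracting the uniform motion \<open>s *\<^sub>R y t\<close> turns the
      comparison with a constant velocity into a plain derivative bound.\<close>
    have "norm ((x (t + T) - (t + T) *\<^sub>R y t) - (x t - t *\<^sub>R y t)) \<le> e / 2 * (t + T - t)"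
    proof (rule vector_derivative_bound_Icc)
      fix s assume s: "s \<in> {t..t + T}"
      have "(x has_vector_derivative y s + z s) (at s within {t..t + T})"
        using N(3) \<open>t \<ge> N\<close> s
        by (intro has_vector_derivative_within_subset[OF x]) (auto intro: order_trans)
      then show "((\<lambda>s. x s - s *\<^sub>R y t) has_vector_derivative y s + z s - 1 *\<^sub>R y t)
          (at s within {t..t + T})"
        by (intro derivative_intros) (auto intro!: derivative_eq_intros)
      have "norm (y s + z s - 1 *\<^sub>R y t) = norm ((y s - y t) + z s)" by (simp add: algebra_simps)
      also have "\<dots> \<le> norm (y s - y t) + norm (z s)" by (rule norm_triangle_ineq)
      also have "\<dots> \<le> e / 2" using y_near[OF s] N(2)[of s] s \<open>t \<ge> N\<close> by auto
      finally show "norm (y s + z s - 1 *\<^sub>R y t) \<le> e / 2" .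
    qed (use \<open>T > 0\<close> in auto)
    then have "norm ((x (t + T) - x t) - T *\<^sub>R y t) \<le> e / 2 * T" by (simp add: algebra_simps)
    moreover have "norm (T *\<^sub>R y t) \<le> norm ((x (t + T) - x t) - T *\<^sub>R y t) + norm (x (t + T) - x t)"
      by (metis norm_minus_commute norm_triangle_sub add.commute)
    moreover have "norm (x (t + T) - x t) \<le> 2 * M"
      using norm_triangle_ineq4[of "x (t + T)" "x t"] M[of "t + T"] M[of t] N(3)[OF that] \<open>T > 0\<close>
      by simp
    ultimately have "T * norm (y t) \<le> e / 2 * T + 2 * M" using \<open>T > 0\<close> by simp
    also have "2 * M = e / 4 * T" using \<open>e > 0\<close> by (simp add: T_def)
    finally have "T * norm (y t) \<le> T * (3 / 4 * e)" by (simp add: algebra_simps)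
    then have "norm (y t) \<le> 3 / 4 * e" using \<open>T > 0\<close> by simp
    then show ?thesis using \<open>e > 0\<close> by simp
  qed
  then show "\<forall>\<^sub>F t in at_top. dist (y t) 0 < e"
    by (intro eventually_at_top_linorderI[of N]) auto
qed

text \<open>A Gronwall argument: if \<open>M\<close> bounds \<open>a\<close> on
  \<open>{0..T}\<close>, the weight \<open>exp (- 2 * M * t)\<close> makes the square of
  \<open>g\<close> nonincreasing, and it starts at 0. It serves to show that headings keep unit
  length.\<close>

lemma linear_ode_zero:
  fixes g a :: "real \<Rightarrow> real"
  assumes g: "\<And>t. t \<ge> 0 \<Longrightarrow> (g has_real_derivative a t * g t) (at t within {0..})"
    and a: "continuous_on {0..} a" and "g 0 = 0" and "T \<ge> 0"
  shows "g T = 0"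
proof -
  have "compact (a ` {0..T})"
    using a by (intro compact_continuous_image continuous_on_subset[OF a]) auto
  then obtain M where M: "\<And>t. t \<in> {0..T} \<Longrightarrow> norm (a t) \<le> M"
    using compact_imp_bounded by (fastforce simp: bounded_iff)
  define f where "f t = (g t)\<^sup>2 * exp (- 2 * M * t)" for t
  have "f T - f 0 \<le> 0 * (T - 0)"
  proof (rule real_derivative_bound_Icc[OF \<open>T \<ge> 0\<close>])
    fix t assume t: "t \<in> {0..T}"
    have "(g has_real_derivative a t * g t) (at t within {0..T})"
      using t by (intro DERIV_subset[OF g]) auto
    then show "(f has_real_derivative 2 * (a t - M) * ((g t)\<^sup>2 * exp (- 2 * M * t))) (at t within {0..T})"
      unfolding f_def
      by (auto intro!: derivative_eq_intros simp: algebra_simps power2_eq_square)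
    show "2 * (a t - M) * ((g t)\<^sup>2 * exp (- 2 * M * t)) \<le> 0"
      by (rule mult_nonpos_nonneg) (use M[OF t] in auto)
  qed
  then have "(g T)\<^sup>2 * exp (- 2 * M * T) \<le> 0" by (simp add: f_def \<open>g 0 = 0\<close>)
  then show ?thesis by (simp add: mult_le_0_iff)
qed

section \<open>Bearing maps and rigidity\<close>

lemma outer_mult_vec: "outer x y *v z = (y \<bullet> z) *\<^sub>R x"
  by (simp add: vec_eq_iff outer_def matrix_vector_mult_def inner_vec_def sum_distrib_right
      sum_distrib_left mult_ac)

lemma orth_proj_mult_vec: "orth_proj g *v x = x - (g \<bullet> x) *\<^sub>R g"
  by (simp add: orth_proj_def matrix_vector_mult_diff_rdistrib outer_mult_vec)

lemma orth_proj_uminus: "orth_proj (- g) = orth_proj g"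
  by (simp add: orth_proj_def outer_def vec_eq_iff)

lemma bearing_commute: "bearing q j i = - bearing q i j"
  by (simp add: bearing_def norm_minus_commute[of "q $ i"] flip: scaleR_minus_right)

lemma norm_bearing: "q $ i \<noteq> q $ j \<Longrightarrow> norm (bearing q i j) = 1"
  by (simp add: bearing_def)

lemma orth_proj_self_adjoint: "(orth_proj g *v x) \<bullet> y = x \<bullet> (orth_proj g *v y)"
  by (simp add: orth_proj_mult_vec inner_diff_left inner_diff_right inner_commute mult.commute)

lemma orth_proj_idem:
  assumes "norm g = 1"
  shows "orth_proj g *v (orth_proj g *v x) = orth_proj g *v x"
proof -
  have "g \<bullet> g = 1" using assms by (simp add: norm_eq_1)
  then show ?thesis by (simp add: orth_proj_mult_vec inner_diff_right)
qed

text \<open>This is the bearing rigidity matrix without its edge-length factors, with one block row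
  for each orientation of an edge. Extending it by zero to all ordered pairs makes the codomain a
  Euclidean space that does not depend on \<open>E\<close>.\<close>

definition bearing_map :: "('v::finite \<times> 'v) set \<Rightarrow> real^'d^'v \<Rightarrow> real^'d^'v \<Rightarrow> real^'d^('v \<times> 'v)"
  where "bearing_map E q x =
    (\<chi> k. if k \<in> E then orth_proj (bearing q (fst k) (snd k)) *v (x $ fst k - x $ snd k) else 0)"

lemma linear_bearing_map: "linear (bearing_map E q)"
  by (rule linearI)
    (auto simp: bearing_map_def vec_eq_iff matrix_vector_mult_diff_distrib matrix_vector_right_distrib
      matrix_vector_mult_scaleR algebra_simps)

lemma linear_displacement_input: "linear (\<lambda>x. displacement_input E q x i)"
proof (rule linearI)
  fix x y show "displacement_input E q (x + y) i = displacement_input E q x i + displacement_input E q y i"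
    by (simp add: displacement_input_def matrix_vector_mult_diff_distrib matrix_vector_right_distrib
        sum.distrib sum_subtractf algebra_simps)
next
  fix c :: real and x
  show "displacement_input E q (c *\<^sub>R x) i = c *\<^sub>R displacement_input E q x i"
    by (simp add: displacement_input_def matrix_vector_mult_scaleR scaleR_sum_right
        flip: scaleR_diff_right)
qed

lemmas bounded_linear_bearing_map = linear_bearing_map[unfolded linear_conv_bounded_linear]
lemmas bounded_linear_displacement_input =
  linear_displacement_input[unfolded linear_conv_bounded_linear]

text \<open>Each projection is self-adjoint and idempotent, so one of the two copies can be moved
  away; reversing the orientation of the edges then identifies the two halves of the sum. The factor
  2 counts both orientations, and the sign is that of \<open>displacement_input\<close>, which is
  minus the Laplacian. With \<open>y = x\<close> the left side is twice the Laplacian quadratic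
  form.\<close>

lemma inner_bearing_map:
  fixes E :: "('v::finite \<times> 'v) set" and q x y :: "real^'d^'v"
  assumes "sym E" and nc: "\<And>i j. (i, j) \<in> E \<Longrightarrow> q $ i \<noteq> q $ j"
  shows "bearing_map E q x \<bullet> bearing_map E q y = - 2 * (\<Sum>i\<in>UNIV. displacement_input E q x i \<bullet> y $ i)"
proof -
  define T where "T i j = orth_proj (bearing q i j) *v (x $ i - x $ j)" for i j
  have T_swap: "T j i = - T i j" for i j
    by (simp add: T_def bearing_commute[of q j i] orth_proj_uminus matrix_vector_mult_diff_distrib)
  have "bearing_map E q x \<bullet> bearing_map E q y
      = (\<Sum>k\<in>UNIV. if k \<in> E then T (fst k) (snd k) \<bullet> (y $ fst k - y $ snd k) else 0)"
    unfolding inner_vec_def[of "bearing_map E q x"]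
  proof (rule sum.cong[OF refl])
    fix k :: "'v \<times> 'v"
    show "bearing_map E q x $ k \<bullet> bearing_map E q y $ k
        = (if k \<in> E then T (fst k) (snd k) \<bullet> (y $ fst k - y $ snd k) else 0)"
      using nc[of "fst k" "snd k"]
      by (auto simp: bearing_map_def T_def orth_proj_idem norm_bearing
          orth_proj_self_adjoint[symmetric])
  qed
  also have "\<dots> = (\<Sum>(i, j)\<in>E. T i j \<bullet> (y $ i - y $ j))"
    by (simp add: sum.If_cases case_prod_beta)
  also have "\<dots> = (\<Sum>(i, j)\<in>E. T i j \<bullet> y $ i) - (\<Sum>(i, j)\<in>E. T i j \<bullet> y $ j)"
    by (simp add: case_prod_beta inner_diff_right sum_subtractf)
  \<comment> \<open>Swapping the endpoints permutes the symmetric edge set; \<open>T_swap\<close>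
    then supplies the sign.\<close>
  also have "(\<Sum>(i, j)\<in>E. T i j \<bullet> y $ j) = (\<Sum>(i, j)\<in>E. T j i \<bullet> y $ i)"
    using \<open>sym E\<close> by (intro sum.reindex_bij_witness[of _ prod.swap prod.swap]) (auto dest: symD)
  also have "\<dots> = - (\<Sum>(i, j)\<in>E. T i j \<bullet> y $ i)"
  proof -
    have "(\<lambda>(i, j). T j i \<bullet> y $ i) = (\<lambda>(i, j). - (T i j \<bullet> y $ i))"
      by (intro ext) (clarsimp, metis T_swap inner_minus_left)
    then show ?thesis by (simp add: case_prod_beta sum_negf)
  qed
  also have "(\<Sum>(i, j)\<in>E. T i j \<bullet> y $ i) = (\<Sum>i\<in>UNIV. \<Sum>j | (i, j) \<in> E. T i j \<bullet> y $ i)"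
    by (subst sum.Sigma) (auto intro!: sum.cong)
  also have "\<dots> = - (\<Sum>i\<in>UNIV. displacement_input E q x i \<bullet> y $ i)"
    by (simp add: displacement_input_def T_def inner_sum_left sum_negf)
  finally show ?thesis by simp
qed

lemma orth_proj_bearing_self: "orth_proj (bearing q i j) *v (q $ i - q $ j) = 0"
proof (cases "q $ i = q $ j")
  case False
  have "q $ i - q $ j = - norm (q $ j - q $ i) *\<^sub>R bearing q i j"
    using False by (simp add: bearing_def)
  moreover have "bearing q i j \<bullet> bearing q i j = 1"
    using norm_bearing[OF False] by (simp add: norm_eq_1)
  ultimately show ?thesis by (simp add: orth_proj_mult_vec)
qed simp

lemma displacement_input_target: "displacement_input E q (target q v t) i = 0"
  by (simp add: displacement_input_def target_def orth_proj_bearing_self)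

text \<open>Links the matrix in which rigidity is stated to the control input. Without self-loops
  the off-diagonal blocks of row \<open>i\<close> run over exactly the neighbors of
  \<open>i\<close>, and the diagonal block collects the matching terms in
  \<open>x $ i\<close>.\<close>

lemma bearing_laplacian_mult_stack:
  fixes E :: "('v::finite \<times> 'v) set" and q x :: "real^'d^'v"
  assumes "irrefl E"
  shows "bearing_laplacian E q *v stack x = - stack (\<chi> i. displacement_input E q x i)"
proof -
  have block: "(\<Sum>j\<in>UNIV. laplacian_block E q i j *v x $ j) = - displacement_input E q x i" for i
  proof -
    have sum_mult: "(\<Sum>k\<in>K. A k) *v y = (\<Sum>k\<in>K. A k *v y)"
      for K :: "'v set" and A :: "'v \<Rightarrow> real^'d^'d" and y
      by (induction K rule: infinite_finite_induct) (auto simp: matrix_vector_mult_add_rdistrib)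
    have "(i, i) \<notin> E" using \<open>irrefl E\<close> by (simp add: irrefl_def)
    then have "(\<Sum>j\<in>UNIV - {i}. laplacian_block E q i j *v x $ j)
        = (\<Sum>j | (i, j) \<in> E. - (orth_proj (bearing q i j) *v x $ j))"
      by (intro sum.mono_neutral_cong_right)
        (auto simp: laplacian_block_def matrix_vector_mult_diff_rdistrib[of 0, simplified])
    then show ?thesis
      by (subst sum.remove[of _ i])
        (auto simp: laplacian_block_def sum_mult displacement_input_def
          matrix_vector_mult_diff_distrib sum_subtractf sum_negf)
  qed
  have "(bearing_laplacian E q *v stack x) $ (i, a) = - displacement_input E q x i $ a" for i a
  proof -
    have "(bearing_laplacian E q *v stack x) $ (i, a)
        = (\<Sum>j\<in>UNIV. \<Sum>b\<in>UNIV. laplacian_block E q i j $ a $ b * x $ j $ b)"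
      by (simp add: matrix_vector_mult_def bearing_laplacian_def stack_def sum.cartesian_product
          case_prod_beta UNIV_Times_UNIV)
    also have "\<dots> = (\<Sum>j\<in>UNIV. laplacian_block E q i j *v x $ j) $ a"
      by (simp add: matrix_vector_mult_def)
    finally show ?thesis by (simp add: block)
  qed
  then show ?thesis by (auto simp: vec_eq_iff stack_def)
qed

text \<open>The edges added between leaders constrain nothing new, because \<open>x\<close> vanishes
  at both ends; hence \<open>x\<close> lies in the kernel of the augmented Laplacian and is a
  translation plus a scaling. Two leaders at distinct target positions and with zero displacement
  exclude the scaling, and then the translation.\<close>

lemma rigid_bearing_map_injective:
  fixes E :: "('v::finite \<times> 'v) set" and q x :: "real^'d^'v"
  assumes "irrefl E" and "card L \<ge> 2"
    and nc: "\<And>i j. (i, j) \<in> augmented_edges E L \<Longrightarrow> q $ i \<noteq> q $ j"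
    and rigid: "inf_bearing_rigid (augmented_edges E L) q"
    and x: "\<And>i. i \<in> L \<Longrightarrow> x $ i = 0" "bearing_map E q x = 0"
  shows "x = 0"
proof -
  let ?T = "range (\<lambda>a. stack (\<chi> i. axis a 1)) :: (real^('v \<times> 'd)) set"
  have "orth_proj (bearing q i j) *v (x $ i - x $ j) = 0" if "(i, j) \<in> augmented_edges E L" for i j
  proof (cases "(i, j) \<in> E")
    case True
    then show ?thesis
      using arg_cong[OF x(2), of "\<lambda>y. y $ (i, j)"] by (simp add: bearing_map_def)
  next
    case False
    then show ?thesis using that x(1) by (simp add: augmented_edges_def)
  qed
  then have "displacement_input (augmented_edges E L) q x i = 0" for i
    by (simp add: displacement_input_def)
  moreover have "irrefl (augmented_edges E L)"
    using \<open>irrefl E\<close> by (auto simp: irrefl_def augmented_edges_def)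
  ultimately have "bearing_laplacian (augmented_edges E L) q *v stack x = 0"
    by (simp add: bearing_laplacian_mult_stack) (simp add: vec_eq_iff stack_def)
  then have "stack x \<in> span (insert (stack q) ?T)"
    using rigid by (auto simp: inf_bearing_rigid_def)
  then obtain c where c: "stack x - c *\<^sub>R stack q \<in> span ?T"
    by (auto simp: span_insert)
  have transl: "y $ (i, a) = y $ (j, a)" if "y \<in> span ?T" for y i j a
    using that by (induction rule: span_induct) (auto simp: subspace_def stack_def)
  obtain i j where ij: "i \<in> L" "j \<in> L" "i \<noteq> j"
    using \<open>card L \<ge> 2\<close> by (metis card_2_iff' card_le_Suc0_iff_eq card_eq_0_iff not_less_eq_eq
        numeral_2_eq_2 not_numeral_le_zero)
  \<comment> \<open>After removal of the scaling part the remainder is the same at all agents; at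
    the two leaders it equals \<open>- c *\<^sub>R q $ i\<close> and
    \<open>- c *\<^sub>R q $ j\<close>.\<close>
  have "c *\<^sub>R q $ i = c *\<^sub>R q $ j"
    using transl[OF c, of i _ j] x(1) ij by (simp add: vec_eq_iff stack_def)
  then have "c = 0" using nc[of i j] ij by (simp add: augmented_edges_def)
  then have "x $ k = x $ i" for k
    using transl[OF c, of k _ i] by (simp add: vec_eq_iff stack_def)
  then show ?thesis using x(1) ij by (simp add: vec_eq_iff)
qed

text \<open>An injective linear map on a finite-dimensional subspace is bounded below. This makes
  the potential energy control the full error.\<close>

lemma rigid_bearing_map_coercive:
  fixes E :: "('v::finite \<times> 'v) set" and q :: "real^'d^'v"
  assumes "irrefl E" and "card L \<ge> 2"
    and nc: "\<And>i j. (i, j) \<in> augmented_edges E L \<Longrightarrow> q $ i \<noteq> q $ j"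
    and rigid: "inf_bearing_rigid (augmented_edges E L) q"
  obtains m where "m > 0"
    "\<And>x. (\<And>i. i \<in> L \<Longrightarrow> x $ i = 0) \<Longrightarrow> m * norm x \<le> norm (bearing_map E q x)"
proof -
  let ?S = "{x :: real^'d^'v. \<forall>i\<in>L. x $ i = 0}"
  have "subspace ?S" by (auto simp: subspace_def)
  moreover have "\<forall>x\<in>?S. bearing_map E q x = 0 \<longrightarrow> x = 0"
    using rigid_bearing_map_injective[OF assms] by blast
  ultimately have "\<exists>m>0. \<forall>x\<in>?S. m * norm x \<le> norm (bearing_map E q x)"
    by (intro injective_imp_isometric closed_subspace linear_conv_bounded_linear[THEN iffD1]
        linear_bearing_map) auto
  then show ?thesis using that by blast
qed

section \<open>The error dynamics of the followers\<close>

text \<open>The closed loop in terms of the error \<open>e\<close>, with the projections expanded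
  into inner products. Rigidity enters only through the coercivity constant
  \<open>m\<close>.\<close>

locale follower_error_system =
  fixes E :: "('v::finite \<times> 'v) set" and L :: "'v set" and q :: "real^'d^'v"
    and v :: "real^'d" and k\<^sub>1 k\<^sub>2 m :: real and e h \<xi> :: "real \<Rightarrow> real^'d^'v"
    and r :: "real \<Rightarrow> 'v \<Rightarrow> real^'d"
  defines "r \<equiv> \<lambda>t i. displacement_input E q (e t) i"
  assumes sym: "sym E"
    and noncoincident: "\<And>i j. (i, j) \<in> E \<Longrightarrow> q $ i \<noteq> q $ j"
    and gains: "k\<^sub>1 > 0" "k\<^sub>2 > 0"
    and coercive: "m > 0"
      "\<And>x. (\<And>i. i \<in> L \<Longrightarrow> x $ i = 0) \<Longrightarrow> m * norm x \<le> norm (bearing_map E q x)"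
    and leader_error: "\<And>i t. i \<in> L \<Longrightarrow> t \<ge> 0 \<Longrightarrow> e t $ i = 0"
    and heading_0: "\<And>i. i \<notin> L \<Longrightarrow> norm (h 0 $ i) = 1"
    and follower_error: "\<And>i t. i \<notin> L \<Longrightarrow> t \<ge> 0 \<Longrightarrow>
      ((\<lambda>s. e s $ i) has_vector_derivative
        (h t $ i \<bullet> (k\<^sub>1 *\<^sub>R r t i + \<xi> t $ i)) *\<^sub>R h t $ i - v) (at t within {0..})"
    and follower_aux: "\<And>i t. i \<notin> L \<Longrightarrow> t \<ge> 0 \<Longrightarrow>
      ((\<lambda>s. \<xi> s $ i) has_vector_derivative
        (h t $ i \<bullet> r t i) *\<^sub>R h t $ i - (\<xi> t $ i - (h t $ i \<bullet> \<xi> t $ i) *\<^sub>R h t $ i)) (at t within {0..})"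
    and follower_heading: "\<And>i t. i \<notin> L \<Longrightarrow> t \<ge> 0 \<Longrightarrow>
      ((\<lambda>s. h s $ i) has_vector_derivative
        k\<^sub>2 *\<^sub>R (r t i + \<xi> t $ i - (h t $ i \<bullet> (r t i + \<xi> t $ i)) *\<^sub>R h t $ i)) (at t within {0..})"
begin

section \<open>Lyapunov function and its decay\<close>

definition error_velocity :: "real \<Rightarrow> real^'d^'v" where
  "error_velocity t = (\<chi> i. if i \<in> L then 0
     else (h t $ i \<bullet> (k\<^sub>1 *\<^sub>R r t i + \<xi> t $ i)) *\<^sub>R h t $ i - v)"

definition aux_orth :: "real \<Rightarrow> 'v \<Rightarrow> real^'d" where
  "aux_orth t i = \<xi> t $ i - (h t $ i \<bullet> \<xi> t $ i) *\<^sub>R h t $ i"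

definition dissipation :: "real \<Rightarrow> 'v \<Rightarrow> real" where
  "dissipation t i = k\<^sub>1 * (h t $ i \<bullet> r t i)\<^sup>2 + (norm (aux_orth t i))\<^sup>2"

text \<open>The factor \<open>1 / 4\<close> yields half the Laplacian quadratic form, since
  \<open>bearing_map\<close> counts every edge twice. The heading term is nonnegative for unit
  headings, and its weight \<open>1 / k\<^sub>2\<close> cancels the gain in the heading
  equation.\<close>

definition lyapunov :: "real \<Rightarrow> real" where
  "lyapunov t = (norm (bearing_map E q (e t)))\<^sup>2 * (1 / 4)
     + (\<Sum>i\<in>- L. (norm (\<xi> t $ i - v))\<^sup>2 * (1 / 2) + (norm v - v \<bullet> h t $ i) * (1 / k\<^sub>2))"

lemma error_deriv:
  assumes "t \<ge> 0"
  shows "(e has_vector_derivative error_velocity t) (at t within {0..})"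
proof (rule has_vector_derivative_vecI)
  fix i
  show "((\<lambda>s. e s $ i) has_vector_derivative error_velocity t $ i) (at t within {0..})"
  proof (cases "i \<in> L")
    case True
    have "((\<lambda>s. e s $ i) has_vector_derivative 0) (at t within {0..})"
      using True assms leader_error
      \<comment> \<open>A leader's error is known to vanish for nonnegative times, so the derivative
        is transferred from the zero function within \<open>{0..}\<close>; the radius 1 is
        arbitrary.\<close>
      by (intro has_vector_derivative_transform_within[OF has_vector_derivative_const, of 1]) auto
    then show ?thesis using True by (simp add: error_velocity_def)
  next
    case False
    then show ?thesis using follower_error[OF False assms] by (simp add: error_velocity_def)
  qed
qed

lemma input_deriv:
  assumes "t \<ge> 0"
  shows "((\<lambda>s. r s i) has_vector_derivative displacement_input E q (error_velocity t) i) (at t within {0..})"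
  unfolding r_def
  by (rule bounded_linear.has_vector_derivative[OF bounded_linear_displacement_input error_deriv[OF assms]])

lemma continuous_input: "continuous_on {0..} (\<lambda>t. r t i)"
  using input_deriv by (auto simp: continuous_on_eq_continuous_within intro: has_vector_derivative_continuous)

lemma continuous_follower:
  assumes "i \<notin> L"
  shows "continuous_on {0..} (\<lambda>t. \<xi> t $ i)" "continuous_on {0..} (\<lambda>t. h t $ i)"
  using follower_aux[OF assms] follower_heading[OF assms]
  by (auto simp: continuous_on_eq_continuous_within intro: has_vector_derivative_continuous)

text \<open>The defect \<open>1 - h t $ i \<bullet> h t $ i\<close> solves a homogeneous linear
  equation with continuous coefficient and is zero initially.\<close>

lemma norm_heading:
  assumes "i \<notin> L" "t \<ge> 0"
  shows "norm (h t $ i) = 1"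
proof -
  let ?y = "\<lambda>t. r t i + \<xi> t $ i"
  have "1 - h t $ i \<bullet> h t $ i = 0"
  proof (rule linear_ode_zero[where g = "\<lambda>t. 1 - h t $ i \<bullet> h t $ i" and a = "\<lambda>t. - 2 * k\<^sub>2 * (h t $ i \<bullet> ?y t)"])
    fix s :: real assume "s \<ge> 0"
    note D = follower_heading[OF \<open>i \<notin> L\<close> this, unfolded has_vector_derivative_def]
    show "((\<lambda>s. 1 - h s $ i \<bullet> h s $ i) has_real_derivative
        - 2 * k\<^sub>2 * (h s $ i \<bullet> ?y s) * (1 - h s $ i \<bullet> h s $ i)) (at s within {0..})"
      unfolding has_field_derivative_def
      by (rule has_derivative_eq_rhs, (rule derivative_intros D)+)
        (simp add: fun_eq_iff inner_diff_right inner_diff_left inner_commute algebra_simps)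
  next
    show "continuous_on {0..} (\<lambda>t. - 2 * k\<^sub>2 * (h t $ i \<bullet> ?y t))"
      by (intro continuous_intros continuous_follower continuous_input \<open>i \<notin> L\<close>)
    show "1 - h 0 $ i \<bullet> h 0 $ i = 0"
      using heading_0[OF \<open>i \<notin> L\<close>] by (simp add: norm_eq_1)
  qed fact
  then show ?thesis by (simp add: norm_eq_1)
qed

lemma heading_inner_self: "i \<notin> L \<Longrightarrow> t \<ge> 0 \<Longrightarrow> h t $ i \<bullet> h t $ i = 1"
  using norm_heading by (simp add: norm_eq_1)

lemma lyapunov_deriv:
  assumes "t \<ge> 0"
  shows "(lyapunov has_real_derivative - (\<Sum>i\<in>- L. dissipation t i)) (at t within {0..})"
proof -
  let ?F = "bearing_map E q"
  let ?D = "\<lambda>i. (\<xi> t $ i - v) \<bullet> ((h t $ i \<bullet> r t i) *\<^sub>R h t $ i - aux_orth t i)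
     - v \<bullet> (r t i + \<xi> t $ i - (h t $ i \<bullet> (r t i + \<xi> t $ i)) *\<^sub>R h t $ i)"
  have F: "((\<lambda>s. ?F (e s)) has_vector_derivative ?F (error_velocity t)) (at t within {0..})"
    by (rule bounded_linear.has_vector_derivative[OF bounded_linear_bearing_map error_deriv[OF assms]])
  have 1: "((\<lambda>s. (norm (?F (e s)))\<^sup>2 * (1 / 4)) has_real_derivative
      ?F (e t) \<bullet> ?F (error_velocity t) / 2) (at t within {0..})"
    unfolding has_field_derivative_def power2_norm_eq_inner
    by (rule has_derivative_eq_rhs,
        (rule derivative_intros F[unfolded has_vector_derivative_def])+)
      (simp add: fun_eq_iff inner_commute)
  have 2: "((\<lambda>s. (norm (\<xi> s $ i - v))\<^sup>2 * (1 / 2) + (norm v - v \<bullet> h s $ i) * (1 / k\<^sub>2)) has_real_derivative ?D i)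
      (at t within {0..})" if "i \<in> - L" for i
  proof -
    have "i \<notin> L" using that by simp
    note X = follower_aux[OF this assms, unfolded has_vector_derivative_def]
      and H = follower_heading[OF this assms, unfolded has_vector_derivative_def]
    show ?thesis
      unfolding has_field_derivative_def power2_norm_eq_inner
      by (rule has_derivative_eq_rhs,
          (rule derivative_intros X H)+)
        (use gains(2) in \<open>simp add: fun_eq_iff inner_commute aux_orth_def field_simps
            inner_diff_left inner_diff_right inner_add_left inner_add_right\<close>)
  qed
  \<comment> \<open>Only followers contribute, because the error velocity of a leader is
    zero.\<close>
  have pot: "?F (e t) \<bullet> ?F (error_velocity t) / 2 = (\<Sum>i\<in>- L. - (r t i \<bullet> error_velocity t $ i))"
  proof -
    have "?F (e t) \<bullet> ?F (error_velocity t) = - 2 * (\<Sum>i\<in>UNIV. r t i \<bullet> error_velocity t $ i)"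
      unfolding r_def by (rule inner_bearing_map[OF sym noncoincident])
    also have "(\<Sum>i\<in>UNIV. r t i \<bullet> error_velocity t $ i) = (\<Sum>i\<in>- L. r t i \<bullet> error_velocity t $ i)"
      by (intro sum.mono_neutral_right) (auto simp: error_velocity_def)
    finally show ?thesis by (simp add: sum_negf)
  qed
  \<comment> \<open>The products of \<open>h \<bullet> r\<close> and
    \<open>h \<bullet> \<xi>\<close> from the potential and from the auxiliary equation cancel. What
    remains with \<open>v\<close>, namely its inner products with the parts of \<open>r\<close> and
    \<open>\<xi>\<close> orthogonal to \<open>h\<close>, is cancelled by the heading term.\<close>
  have diss: "- (r t i \<bullet> error_velocity t $ i) + ?D i = - dissipation t i" if "i \<in> - L" for i
    using that heading_inner_self[of i t] assms
    unfolding dissipation_def aux_orth_def power2_norm_eq_inner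
    by (simp add: error_velocity_def power2_eq_square
        inner_diff_left inner_diff_right inner_add_left inner_add_right
        inner_commute algebra_simps)
  have "?F (e t) \<bullet> ?F (error_velocity t) / 2 + (\<Sum>i\<in>- L. ?D i) = - (\<Sum>i\<in>- L. dissipation t i)"
    unfolding pot sum.distrib[symmetric] sum_negf[symmetric] by (rule sum.cong[OF refl diss])
  moreover have "(lyapunov has_real_derivative
      ?F (e t) \<bullet> ?F (error_velocity t) / 2 + (\<Sum>i\<in>- L. ?D i)) (at t within {0..})"
    unfolding lyapunov_def by (intro DERIV_add 1 DERIV_sum 2)
  ultimately show ?thesis by simp
qed

lemma dissipation_nonneg: "0 \<le> dissipation t i"
  using gains(1) by (simp add: dissipation_def)

lemma lyapunov_antimono:
  assumes "t \<ge> 0"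
  shows "lyapunov t \<le> lyapunov 0"
proof -
  have "lyapunov t - lyapunov 0 \<le> 0 * (t - 0)"
  proof (rule real_derivative_bound_Icc[OF assms])
    fix s assume "s \<in> {0..t}"
    then show "(lyapunov has_real_derivative - (\<Sum>i\<in>- L. dissipation s i)) (at s within {0..t})"
      by (intro DERIV_subset[OF lyapunov_deriv]) auto
    show "- (\<Sum>i\<in>- L. dissipation s i) \<le> 0" by (simp add: sum_nonneg dissipation_nonneg)
  qed
  then show ?thesis by simp
qed

lemma lyapunov_summand_nonneg:
  assumes "i \<in> - L" "t \<ge> 0"
  shows "0 \<le> (norm v - v \<bullet> h t $ i) * (1 / k\<^sub>2)"
proof -
  have "v \<bullet> h t $ i \<le> norm v"
    using norm_cauchy_schwarz[of v "h t $ i"] norm_heading[of i t] assms by simp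
  then show ?thesis using gains(2) by simp
qed

text \<open>All summands of \<open>lyapunov\<close> are nonnegative, so each of them is bounded by
  the whole.\<close>

lemma
  assumes "t \<ge> 0"
  shows lyapunov_nonneg: "0 \<le> lyapunov t"
    and bearing_map_le_lyapunov: "(norm (bearing_map E q (e t)))\<^sup>2 \<le> 4 * lyapunov t"
    and aux_le_lyapunov: "i \<notin> L \<Longrightarrow> (norm (\<xi> t $ i - v))\<^sup>2 \<le> 2 * lyapunov t"
proof -
  let ?S = "\<lambda>i. (norm (\<xi> t $ i - v))\<^sup>2 * (1 / 2) + (norm v - v \<bullet> h t $ i) * (1 / k\<^sub>2)"
  have S: "(norm (\<xi> t $ i - v))\<^sup>2 * (1 / 2) \<le> ?S i" if "i \<in> - L" for i
    using lyapunov_summand_nonneg[OF that assms] by simp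
  have S_nonneg: "0 \<le> ?S i" if "i \<in> - L" for i
    using order_trans[OF _ S[OF that]] by simp
  then have sum: "0 \<le> (\<Sum>i\<in>- L. ?S i)" by (intro sum_nonneg)
  then show "(norm (bearing_map E q (e t)))\<^sup>2 \<le> 4 * lyapunov t" by (simp add: lyapunov_def)
  show "0 \<le> lyapunov t" using sum by (simp add: lyapunov_def)
  show "(norm (\<xi> t $ i - v))\<^sup>2 \<le> 2 * lyapunov t" if "i \<notin> L"
  proof -
    have "(norm (\<xi> t $ i - v))\<^sup>2 * (1 / 2) \<le> ?S i" using that by (intro S) simp
    also have "\<dots> \<le> (\<Sum>i\<in>- L. ?S i)" using that S_nonneg by (intro member_le_sum) auto
    also have "\<dots> \<le> lyapunov t" by (simp add: lyapunov_def)
    finally show ?thesis by simp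
  qed
qed

section \<open>Boundedness and uniform continuity of the signals\<close>

lemma bounded_error: "bounded (e ` {0..})"
proof (rule boundedI)
  fix y assume "y \<in> e ` {0..}"
  then obtain t where t: "t \<ge> 0" "y = e t" by auto
  have "m * norm (e t) \<le> norm (bearing_map E q (e t))"
    using leader_error t(1) by (intro coercive(2)) auto
  also have "\<dots> \<le> sqrt (4 * lyapunov 0)"
    using bearing_map_le_lyapunov[OF t(1)] lyapunov_antimono[OF t(1)] by (intro real_le_rsqrt) simp
  finally show "norm y \<le> sqrt (4 * lyapunov 0) / m"
    using coercive(1) t(2) by (simp add: field_simps)
qed

lemma bounded_aux:
  assumes "i \<notin> L"
  shows "bounded ((\<lambda>t. \<xi> t $ i) ` {0..})"
proof (rule boundedI)
  fix y assume "y \<in> (\<lambda>t. \<xi> t $ i) ` {0..}"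
  then obtain t where t: "t \<ge> 0" "y = \<xi> t $ i" by auto
  have "norm (\<xi> t $ i - v) \<le> sqrt (2 * lyapunov 0)"
    using aux_le_lyapunov[OF t(1) assms] lyapunov_antimono[OF t(1)] by (intro real_le_rsqrt) simp
  then show "norm y \<le> sqrt (2 * lyapunov 0) + norm v"
    using norm_triangle_sub[of "\<xi> t $ i" v] t(2) by simp
qed

lemma bounded_input: "bounded ((\<lambda>t. r t i) ` {0..})"
  using bounded_linear_image[OF bounded_error bounded_linear_displacement_input]
  by (simp add: r_def image_image)

text \<open>Collects the signals of which the dissipation and the derivatives of heading and
  auxiliary vector are continuous functions. The input is a separate component because it depends on
  the errors of the neighbors as well.\<close>

definition state :: "'v \<Rightarrow> real \<Rightarrow> (real^'d) \<times> (real^'d) \<times> (real^'d)" where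
  "state i t = (h t $ i, r t i, \<xi> t $ i)"

lemma bounded_state:
  assumes "i \<notin> L"
  shows "bounded (state i ` {0..})"
proof (rule bounded_subset)
  have "bounded ((\<lambda>t. h t $ i) ` {0..})"
    using norm_heading[OF assms] by (auto intro!: boundedI[of _ 1])
  then show "bounded ((\<lambda>t. h t $ i) ` {0..} \<times> (\<lambda>t. r t i) ` {0..} \<times> (\<lambda>t. \<xi> t $ i) ` {0..})"
    by (intro bounded_Times bounded_input bounded_aux assms)
qed (auto simp: state_def)

lemma bounded_state_fun:
  assumes "i \<notin> L" "continuous_on UNIV f"
  shows "bounded ((\<lambda>t. f (state i t)) ` {0..})"
  using bounded_continuous_image[OF bounded_state[OF assms(1)] assms(2)] by (simp add: image_image)

lemma bounded_error_velocity: "bounded (error_velocity ` {0..})"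
proof (rule bounded_vecI)
  fix i
  show "bounded ((\<lambda>t. error_velocity t $ i) ` {0..})"
  proof (cases "i \<in> L")
    case False
    then show ?thesis
      using bounded_state_fun[OF False, of "\<lambda>(h, r, \<xi>). (h \<bullet> (k\<^sub>1 *\<^sub>R r + \<xi>)) *\<^sub>R h - v"]
      by (simp add: error_velocity_def state_def case_prod_beta continuous_intros)
  qed (simp add: error_velocity_def image_constant_conv)
qed

lemma uniformly_continuous_state:
  assumes "i \<notin> L"
  shows "uniformly_continuous_on {0..} (state i)"
proof (rule uniformly_continuous_on_bounded_vector_derivative)
  let ?h' = "\<lambda>(h, r, \<xi>). k\<^sub>2 *\<^sub>R (r + \<xi> - (h \<bullet> (r + \<xi>)) *\<^sub>R h)"
    and ?\<xi>' = "\<lambda>(h, r, \<xi>). (h \<bullet> r) *\<^sub>R h - (\<xi> - (h \<bullet> \<xi>) *\<^sub>R h)"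
    and ?r' = "\<lambda>t. displacement_input E q (error_velocity t) i"
  show "(state i has_vector_derivative (?h' (state i t), ?r' t, ?\<xi>' (state i t))) (at t within {0..})"
    if "t \<ge> 0" for t
    unfolding state_def prod.case
    by (intro has_vector_derivative_Pair follower_heading follower_aux input_deriv assms that)
  have "bounded ((\<lambda>t. ?h' (state i t)) ` {0..})" "bounded ((\<lambda>t. ?\<xi>' (state i t)) ` {0..})"
    by (auto intro!: bounded_state_fun assms continuous_intros simp: case_prod_beta)
  moreover have "bounded (?r' ` {0..})"
    using bounded_linear_image[OF bounded_error_velocity bounded_linear_displacement_input]
    by (simp add: image_image)
  ultimately have "bounded ((\<lambda>t. ?h' (state i t)) ` {0..} \<times> ?r' ` {0..} \<times> (\<lambda>t. ?\<xi>' (state i t)) ` {0..})"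
    by (intro bounded_Times)
  then show "bounded ((\<lambda>t. (?h' (state i t), ?r' t, ?\<xi>' (state i t))) ` {0..})"
    by (rule bounded_subset) auto
qed

section \<open>Convergence of the signals\<close>

text \<open>The dissipation is a continuous function on the compact closure of the range of
  \<open>state i\<close>, hence uniformly continuous there, and it is composed with a uniformly
  continuous curve. The total decay of \<open>lyapunov\<close> dominates the share of each follower,
  so Barbalat applies to one follower at a time.\<close>

lemma dissipation_tendsto_0:
  assumes "i \<notin> L"
  shows "((\<lambda>t. dissipation t i) \<longlongrightarrow> 0) at_top"
proof (rule barbalat_lyapunov[OF lyapunov_deriv])
  show "- (\<Sum>i\<in>- L. dissipation t i) \<le> - dissipation t i" for t
    using assms dissipation_nonneg member_le_sum[of i "- L" "dissipation t"] by auto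
  let ?f = "\<lambda>(h, r, \<xi>). k\<^sub>1 * (h \<bullet> r)\<^sup>2 + (norm (\<xi> - (h \<bullet> \<xi>) *\<^sub>R h))\<^sup>2"
  have "continuous_on (closure (state i ` {0..})) ?f"
    by (auto intro!: continuous_intros simp: case_prod_beta)
  then have "uniformly_continuous_on (closure (state i ` {0..})) ?f"
    using bounded_state[OF assms] by (intro compact_uniformly_continuous) (auto simp: compact_closure)
  then have "uniformly_continuous_on (state i ` {0..}) ?f"
    unfolding uniformly_continuous_on_def using closure_subset by (meson subsetD)
  then have "uniformly_continuous_on {0..} (\<lambda>t. ?f (state i t))"
    using uniformly_continuous_on_compose[OF uniformly_continuous_state[OF assms]] by (simp add: o_def)
  then show "uniformly_continuous_on {0..} (\<lambda>t. dissipation t i)"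
    by (simp add: state_def dissipation_def aux_orth_def)
qed (auto intro: dissipation_nonneg lyapunov_nonneg)

lemma heading_input_tendsto_0:
  assumes "i \<notin> L"
  shows "((\<lambda>t. h t $ i \<bullet> r t i) \<longlongrightarrow> 0) at_top"
proof -
  have "((\<lambda>t. (h t $ i \<bullet> r t i)\<^sup>2) \<longlongrightarrow> 0) at_top"
  proof (rule tendsto_sandwich[OF _ _ tendsto_const])
    show "((\<lambda>t. dissipation t i / k\<^sub>1) \<longlongrightarrow> 0) at_top"
      using tendsto_divide_zero[OF dissipation_tendsto_0[OF assms]] .
    show "\<forall>\<^sub>F t in at_top. (h t $ i \<bullet> r t i)\<^sup>2 \<le> dissipation t i / k\<^sub>1"
      using gains(1) by (simp add: dissipation_def field_simps)
  qed auto
  then show ?thesis by (simp add: power_tendsto_0_iff)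
qed

lemma aux_orth_tendsto_0:
  assumes "i \<notin> L"
  shows "((\<lambda>t. aux_orth t i) \<longlongrightarrow> 0) at_top"
proof -
  have "((\<lambda>t. (norm (aux_orth t i))\<^sup>2) \<longlongrightarrow> 0) at_top"
  proof (rule tendsto_sandwich[OF _ _ tendsto_const])
    show "\<forall>\<^sub>F t in at_top. (norm (aux_orth t i))\<^sup>2 \<le> dissipation t i"
      using gains(1) by (simp add: dissipation_def)
    show "((\<lambda>t. dissipation t i) \<longlongrightarrow> 0) at_top" by (rule dissipation_tendsto_0[OF assms])
  qed auto
  then show ?thesis by (simp add: power_tendsto_0_iff tendsto_norm_zero_iff)
qed

lemma projected_input_tendsto_0:
  assumes "i \<notin> L"
  shows "((\<lambda>t. (h t $ i \<bullet> r t i) *\<^sub>R h t $ i) \<longlongrightarrow> 0) at_top"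
proof (rule Lim_null_comparison)
  show "\<forall>\<^sub>F t in at_top. norm ((h t $ i \<bullet> r t i) *\<^sub>R h t $ i) \<le> \<bar>h t $ i \<bullet> r t i\<bar>"
    using norm_heading[OF assms] by (intro eventually_at_top_linorderI[of 0]) simp
qed (intro tendsto_rabs_zero heading_input_tendsto_0 assms)

text \<open>Used with \<open>c = k\<^sub>1\<close> for the error velocity and with
  \<open>c = 1\<close> for the auxiliary and heading equations.\<close>

lemma drift_remainder_tendsto_0:
  assumes "i \<notin> L"
  shows "((\<lambda>t. c *\<^sub>R ((h t $ i \<bullet> r t i) *\<^sub>R h t $ i) - aux_orth t i) \<longlongrightarrow> 0) at_top"
  using tendsto_diff[OF tendsto_scaleR[OF tendsto_const projected_input_tendsto_0[OF assms]]
      aux_orth_tendsto_0[OF assms], of c] by simp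

lemma error_velocity_follower:
  assumes "i \<notin> L"
  shows "error_velocity t $ i
    = (\<xi> t $ i - v) + (k\<^sub>1 *\<^sub>R ((h t $ i \<bullet> r t i) *\<^sub>R h t $ i) - aux_orth t i)"
  using assms by (simp add: error_velocity_def aux_orth_def inner_add_right algebra_simps)

text \<open>The bounded curve is the error of the follower, and the slow drift is
  \<open>\<xi> - v\<close>, whose derivative is itself a vanishing remainder.\<close>

lemma aux_tendsto:
  assumes "i \<notin> L"
  shows "((\<lambda>t. \<xi> t $ i - v) \<longlongrightarrow> 0) at_top"
proof (rule bounded_slow_drift_tendsto_0)
  show "((\<lambda>s. e s $ i) has_vector_derivative
      (\<xi> t $ i - v) + (k\<^sub>1 *\<^sub>R ((h t $ i \<bullet> r t i) *\<^sub>R h t $ i) - aux_orth t i)) (at t within {0..})"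
    if "t \<ge> 0" for t
    using follower_error[OF assms that] assms
    unfolding error_velocity_follower[OF assms, symmetric] by (simp add: error_velocity_def)
  show "((\<lambda>s. \<xi> s $ i - v) has_vector_derivative
      1 *\<^sub>R ((h t $ i \<bullet> r t i) *\<^sub>R h t $ i) - aux_orth t i) (at t within {0..})" if "t \<ge> 0" for t
    using has_vector_derivative_diff[OF follower_aux[OF assms that] has_vector_derivative_const]
    by (simp add: aux_orth_def)
  show "bounded ((\<lambda>t. e t $ i) ` {0..})"
    using bounded_component_cart[OF bounded_error] by (simp add: image_image)
qed (intro drift_remainder_tendsto_0 assms)+

lemma error_velocity_tendsto_0: "(error_velocity \<longlongrightarrow> 0) at_top"
proof (rule vec_tendstoI)
  fix i
  show "((\<lambda>t. error_velocity t $ i) \<longlongrightarrow> 0 $ i) at_top"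
  proof (cases "i \<in> L")
    case False
    then show ?thesis
      using tendsto_add[OF aux_tendsto[OF False] drift_remainder_tendsto_0[OF False, of k\<^sub>1]]
      by (simp add: error_velocity_follower)
  qed (simp add: error_velocity_def)
qed

text \<open>Here the bounded curve is the heading and the slow drift is
  \<open>k\<^sub>2 *\<^sub>R r\<close>. The input varies slowly because its derivative is a linear
  image of the error velocity of all agents, which vanishes in the limit.\<close>

lemma input_tendsto_0:
  assumes "i \<notin> L"
  shows "((\<lambda>t. r t i) \<longlongrightarrow> 0) at_top"
proof -
  have "((\<lambda>t. k\<^sub>2 *\<^sub>R r t i) \<longlongrightarrow> 0) at_top"
  proof (rule bounded_slow_drift_tendsto_0)
    show "((\<lambda>s. h s $ i) has_vector_derivative
        k\<^sub>2 *\<^sub>R r t i + - k\<^sub>2 *\<^sub>R (1 *\<^sub>R ((h t $ i \<bullet> r t i) *\<^sub>R h t $ i) - aux_orth t i)) (at t within {0..})"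
      if "t \<ge> 0" for t
      using follower_heading[OF assms that]
      by (simp add: aux_orth_def inner_add_right algebra_simps)
    show "bounded ((\<lambda>t. h t $ i) ` {0..})"
      using norm_heading[OF assms] by (auto intro!: boundedI[of _ 1])
    show "((\<lambda>s. k\<^sub>2 *\<^sub>R r s i) has_vector_derivative
        k\<^sub>2 *\<^sub>R displacement_input E q (error_velocity t) i) (at t within {0..})" if "t \<ge> 0" for t
      by (rule bounded_linear.has_vector_derivative[OF bounded_linear_scaleR_right input_deriv[OF that]])
    show "((\<lambda>t. k\<^sub>2 *\<^sub>R displacement_input E q (error_velocity t) i) \<longlongrightarrow> 0) at_top"
      using tendsto_scaleR[OF tendsto_const bounded_linear.tendsto_zero[OF
          bounded_linear_displacement_input error_velocity_tendsto_0], of k\<^sub>2] by simp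
    show "((\<lambda>t. - k\<^sub>2 *\<^sub>R (1 *\<^sub>R ((h t $ i \<bullet> r t i) *\<^sub>R h t $ i) - aux_orth t i)) \<longlongrightarrow> 0) at_top"
      using tendsto_scaleR[OF tendsto_const drift_remainder_tendsto_0[OF assms, of 1], of "- k\<^sub>2"] by simp
  qed
  from tendsto_scaleR[OF tendsto_const this, of "inverse k\<^sub>2"] show ?thesis
    using gains(2) by simp
qed

text \<open>The squared norm of \<open>bearing_map E q (e t)\<close> is a pairing of the inputs with
  the errors. With vanishing inputs and errors bounded by \<open>M\<close> it tends to 0, and
  coercivity passes this on to \<open>e\<close>.\<close>

lemma error_tendsto_0: "(e \<longlongrightarrow> 0) at_top"
proof -
  obtain M where M: "\<And>t. t \<ge> 0 \<Longrightarrow> norm (e t) \<le> M"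
    using bounded_error by (auto simp: bounded_iff)
  define g where "g t = (\<Sum>i\<in>- L. norm (r t i))" for t
  have "(g \<longlongrightarrow> 0) at_top"
    unfolding g_def by (intro tendsto_null_sum tendsto_norm_zero input_tendsto_0) simp
  then have "((\<lambda>t. sqrt (2 * M * g t) / m) \<longlongrightarrow> sqrt (2 * M * 0) / m) at_top"
    using coercive(1) by (intro tendsto_intros) auto
  then have lim: "((\<lambda>t. sqrt (2 * M * g t) / m) \<longlongrightarrow> 0) at_top" by simp
  have "\<forall>\<^sub>F t in at_top. norm (e t) \<le> sqrt (2 * M * g t) / m"
  proof (rule eventually_at_top_linorderI)
    fix t :: real assume "t \<ge> 0"
    have "(norm (bearing_map E q (e t)))\<^sup>2 = - 2 * (\<Sum>i\<in>UNIV. r t i \<bullet> e t $ i)"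
      unfolding power2_norm_eq_inner r_def by (rule inner_bearing_map[OF sym noncoincident])
    also have "(\<Sum>i\<in>UNIV. r t i \<bullet> e t $ i) = (\<Sum>i\<in>- L. r t i \<bullet> e t $ i)"
      using leader_error \<open>t \<ge> 0\<close> by (intro sum.mono_neutral_right) auto
    also have "- 2 * \<dots> = 2 * (\<Sum>i\<in>- L. - (r t i \<bullet> e t $ i))" by (simp add: sum_negf)
    also have "(\<Sum>i\<in>- L. - (r t i \<bullet> e t $ i)) \<le> (\<Sum>i\<in>- L. norm (r t i) * M)"
    proof (rule sum_mono)
      fix i
      have "- (r t i \<bullet> e t $ i) \<le> norm (r t i) * norm (e t $ i)"
        using Cauchy_Schwarz_ineq2[of "r t i" "e t $ i"] by simp
      also have "\<dots> \<le> norm (r t i) * M"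
        using Finite_Cartesian_Product.norm_nth_le[of "e t" i] M[OF \<open>t \<ge> 0\<close>] by (intro mult_left_mono) auto
      finally show "- (r t i \<bullet> e t $ i) \<le> norm (r t i) * M" .
    qed
    finally have "(norm (bearing_map E q (e t)))\<^sup>2 \<le> 2 * M * g t"
      by (simp add: g_def sum_distrib_left mult_ac)
    then have "norm (bearing_map E q (e t)) \<le> sqrt (2 * M * g t)" by (rule real_le_rsqrt)
    moreover have "m * norm (e t) \<le> norm (bearing_map E q (e t))"
      using leader_error \<open>t \<ge> 0\<close> by (intro coercive(2)) auto
    ultimately show "norm (e t) \<le> sqrt (2 * M * g t) / m"
      using coercive(1) by (simp add: field_simps)
  qed
  then show ?thesis using lim by (rule Lim_null_comparison)
qed

end

section \<open>Reduction of the closed loop to the error dynamics\<close>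

theorem theorem2:
  fixes E :: "('v::finite \<times> 'v) set"
    and L :: "'v set"
    and q :: "real^'d^'v"
    and v\<^sub>c h\<^sub>c :: "real^'d"
    and u\<^sub>c k\<^sub>1 k\<^sub>2 :: real
    and p h \<xi> :: "real \<Rightarrow> real^'d^'v"
  defines "r \<equiv> \<lambda>t i. displacement_input E q (p t) i"
  assumes dim: "CARD('d) = 2 \<or> CARD('d) = 3"
    and graph: "sym E" "irrefl E"
    and leaders: "card L \<ge> 2"
    and noncoincident: "\<And>i j. (i, j) \<in> augmented_edges E L \<Longrightarrow> q $ i \<noteq> q $ j"
    and rigid: "inf_bearing_rigid (augmented_edges E L) q"
    and gains: "k\<^sub>1 > 0" "k\<^sub>2 > 0"
    and leader_velocity: "norm h\<^sub>c = 1" "v\<^sub>c = u\<^sub>c *\<^sub>R h\<^sub>c"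
    and leader_motion:
      "\<And>i t. i \<in> L \<Longrightarrow> t \<ge> 0 \<Longrightarrow> p t $ i = target q v\<^sub>c t $ i"
      "\<And>i t. i \<in> L \<Longrightarrow> t \<ge> 0 \<Longrightarrow> h t $ i = h\<^sub>c"
    and follower_heading: "\<And>i. i \<notin> L \<Longrightarrow> norm (h 0 $ i) = 1"
    and follower_p: "\<And>i t. i \<notin> L \<Longrightarrow> t \<ge> 0 \<Longrightarrow>
      ((\<lambda>s. p s $ i) has_vector_derivative
         outer (h t $ i) (h t $ i) *v (k\<^sub>1 *\<^sub>R r t i + \<xi> t $ i)) (at t within {0..})"
    and follower_\<xi>: "\<And>i t. i \<notin> L \<Longrightarrow> t \<ge> 0 \<Longrightarrow>
      ((\<lambda>s. \<xi> s $ i) has_vector_derivative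
         outer (h t $ i) (h t $ i) *v r t i - orth_proj (h t $ i) *v (\<xi> t $ i)) (at t within {0..})"
    and follower_h: "\<And>i t. i \<notin> L \<Longrightarrow> t \<ge> 0 \<Longrightarrow>
      ((\<lambda>s. h s $ i) has_vector_derivative
         k\<^sub>2 *\<^sub>R (orth_proj (h t $ i) *v (r t i + \<xi> t $ i))) (at t within {0..})"
  shows "((\<lambda>t. norm (p t - target q v\<^sub>c t)) \<longlongrightarrow> 0) at_top"
proof -
  let ?e = "\<lambda>t. p t - target q v\<^sub>c t"
  have edges: "q $ i \<noteq> q $ j" if "(i, j) \<in> E" for i j
    using that by (intro noncoincident) (simp add: augmented_edges_def)
  obtain m where m: "m > 0"
    "\<And>x. (\<And>i. i \<in> L \<Longrightarrow> x $ i = 0) \<Longrightarrow> m * norm x \<le> norm (bearing_map E q x)"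
    using rigid_bearing_map_coercive[OF graph(2) leaders noncoincident rigid] by blast
  \<comment> \<open>The input is linear and zero on the target formation, so it depends on positions
    only through the error.\<close>
  have input: "r t i = displacement_input E q (?e t) i" for t i
    by (simp add: r_def linear_diff[OF linear_displacement_input] displacement_input_target)
  have target: "((\<lambda>s. target q v\<^sub>c s $ i) has_vector_derivative v\<^sub>c) (at t within {0..})" for t i
    unfolding target_def by (auto intro!: derivative_eq_intros)
  interpret follower_error_system E L q v\<^sub>c k\<^sub>1 k\<^sub>2 m ?e h \<xi> "\<lambda>t i. displacement_input E q (?e t) i"
  proof (unfold_locales, goal_cases)
    \<comment> \<open>Goals 9 to 11 are the three follower equations; subtracting the target motion
      produces the term \<open>- v\<^sub>c\<close> in the first of them.\<close>
    case (9 i t)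
    show ?case
      using has_vector_derivative_diff[OF follower_p[OF 9] target]
      by (simp add: input outer_mult_vec)
  next
    case (10 i t)
    show ?case using follower_\<xi>[OF 10] by (simp add: input outer_mult_vec orth_proj_mult_vec)
  next
    case (11 i t)
    show ?case using follower_h[OF 11] by (simp add: input orth_proj_mult_vec)
  qed (use graph edges gains m leader_motion(1) follower_heading in auto)
  show ?thesis using error_tendsto_0 by (rule tendsto_norm_zero)
qed

end
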